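(* Let $p_1$ be a prime, $r > 1$ an integer with smallest prime factor $r_1$, and $d$ a positive integer, and let $p' = \min(p_1, r_1)$. Suppose $p_1 r^j + j d$ is prime for every $j = 0, 1, \dots, p'-1$. Then there is no integer $m \ge p'$ such that $p_1 r^j + j d$ is prime for all $j = m, m+1, \dots, m + p' - 1$; that is, the sequence $\{p_1 r^j + j d\}_{j = p'}^{\infty}$ contains no run of $p'$ or more consecutive prime terms.
   Context: A GAP of order $k$ inside the sequence $\{p_1 r^j + jd\}$ means $k$ terms at consecutive indices $j$ that are all prime. *)

theory Defs
  imports "HOL-Computational_Algebra.Primes"
begin

(* GAP of order k whose first index is m. *)
definition prime_gap :: "nat \<Rightarrow> nat \<Rightarrow> nat \<Rightarrow> nat \<Rightarrow> nat \<Rightarrow> bool" where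
  "prime_gap p1 r d m k \<longleftrightarrow> (\<forall>j\<in>{m..<m + k}. prime (p1 * r ^ j + j * d))"

end

theory Submission
  imports Defs
begin

text \<open>
  The number \<open>q = p'\<close> is prime and divides \<open>p\<^sub>1 r\<close>, hence it divides \<open>p\<^sub>1 r\<^sup>j + j d\<close> for every
  positive multiple \<open>j\<close> of \<open>q\<close>. Any \<open>q\<close> consecutive indices contain such a multiple, and for
  \<open>j \<ge> q\<close> the term exceeds \<open>q\<close>, so it is composite.
\<close>

lemma ex_multiple_in_window:
  fixes m q :: nat
  assumes "q > 0"
  shows "\<exists>j\<in>{m..<m + q}. q dvd j"
proof
  \<comment> \<open>The largest multiple of \<open>q\<close> up to the last index
    \<open>m + q - 1\<close> of the window; the remainder is below \<open>q\<close>, so it cannot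
    fall below \<open>m\<close>.\<close>
  let ?j = "q * ((m + q - 1) div q)"
  have "?j + (m + q - 1) mod q = m + q - 1"
    by simp
  moreover have "(m + q - 1) mod q < q"
    using assms by simp
  ultimately show "?j \<in> {m..<m + q}"
    using assms by (simp only: atLeastLessThan_iff) linarith
qed simp

lemma not_prime_term_at_multiple:
  fixes p r d j q :: nat
  assumes "p > 0" "r > 1" "q > 1" "q dvd p * r" "q dvd j" "q \<le> j"
  shows "\<not> prime (p * r ^ j + j * d)"
proof
  assume prime: "prime (p * r ^ j + j * d)"
  \<comment> \<open>Needs \<open>j > 0\<close>, which \<open>1 < q \<le> j\<close> supplies.\<close>
  have "p * r dvd p * r ^ j"
    using assms by (intro mult_dvd_mono dvd_power) auto
  with assms have "q dvd p * r ^ j + j * d"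
    by (meson dvd_add dvd_mult2 dvd_trans)
  with prime \<open>q > 1\<close> have "p * r ^ j + j * d = q"
    by (auto simp: prime_nat_iff)
  \<comment> \<open>Size rules out equality with \<open>q\<close>: the term is at least
    \<open>r ^ j\<close>, and \<open>r ^ j > j \<ge> q\<close>.\<close>
  moreover have "j < r ^ j"
    using \<open>r > 1\<close> by (simp add: power_gt_expt)
  moreover have "r ^ j \<le> p * r ^ j"
    using \<open>p > 0\<close> by simp
  ultimately show False
    using \<open>q \<le> j\<close> by linarith
qed

theorem theorem3:
  fixes p1 r r1 d p' :: nat
  assumes "prime p1"
    and "r > 1"
    and "r1 = Min (prime_factors r)"
    and "d > 0"
    and "p' = min p1 r1"
    and "\<forall>j\<in>{0..<p'}. prime (p1 * r ^ j + j * d)"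
  shows "\<not> (\<exists>m\<ge>p'. \<forall>j\<in>{m..<m + p'}. prime (p1 * r ^ j + j * d))
    \<and> \<not> (\<exists>m\<ge>p'. \<exists>k\<ge>p'. prime_gap p1 r d m k)"
proof -
  have "prime_factors r \<noteq> {}"
    using \<open>r > 1\<close> by (auto simp: prime_factorization_empty_iff)
  then have "r1 \<in> prime_factors r"
    using assms(3) by simp
  \<comment> \<open>The minimum is \<open>p1\<close> or \<open>r1\<close>: both are primes, and each
    divides one factor of \<open>p1 * r\<close>.\<close>
  then have "prime p'" "p' dvd p1 * r"
    using \<open>prime p1\<close> assms(5) by (auto simp: min_def)
  have no_run: "\<exists>j\<in>{m..<m + p'}. \<not> prime (p1 * r ^ j + j * d)" if "m \<ge> p'" for m
  proof -
    obtain j where "j \<in> {m..<m + p'}" "p' dvd j"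
      using ex_multiple_in_window \<open>prime p'\<close> prime_gt_0_nat by blast
    moreover from this have "\<not> prime (p1 * r ^ j + j * d)"
      using \<open>m \<ge> p'\<close> \<open>r > 1\<close> \<open>p' dvd p1 * r\<close> prime_gt_0_nat[OF \<open>prime p1\<close>]
        prime_gt_1_nat[OF \<open>prime p'\<close>]
      by (intro not_prime_term_at_multiple[where q = p']) auto
    ultimately show ?thesis
      by blast
  qed
  \<comment> \<open>The first \<open>p'\<close> indices of a longer run already contain a composite
    term.\<close>
  moreover have "\<not> prime_gap p1 r d m k" if "m \<ge> p'" "k \<ge> p'" for m k
    using no_run[OF \<open>m \<ge> p'\<close>] \<open>k \<ge> p'\<close> by (fastforce simp: prime_gap_def)
  ultimately show ?thesis
    by blast
qed

end
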